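(* Let $f\in\Gamma_0(\mathcal H)$ have non-empty set of minimizers $\Omega$ and minimum value $f^*$. Let $\{x_k\}$, $\{\tilde x_{k+1}\}$, $\{z_k\}$ be generated from $z_0=x_0\in\mathcal H$ by the Symplectic Proximal Point Algorithm: for $k=0,1,\dots$, $$\tilde x_{k+1}=\frac{1}{b_k+1}z_k+\frac{b_k}{b_k+1}x_k,\qquad x_{k+1}=\mathop{\mathrm{argmin}}_{x\in\mathcal H}\Big\{f(x)+\frac{b_k+1}{2c_k}\|x-\tilde x_{k+1}\|_L^2\Big\},\qquad z_{k+1}=z_k+\frac{a_k(b_k+1)}{c_k}(x_{k+1}-\tilde x_{k+1}).$$ Suppose that for all $k\ge0$ $$A_k=a_kb_k,\qquad 0\le A_{k+1}-A_k\le a_k,\qquad c_k\ge\frac{a_k}{2}.$$ For $x^*\in\Omega$ put $\mathcal E(k):=A_k[f(x_k)-f(x^* )]+\frac12\|z_k-x^*\|_L^2$. Then the sequence $\{\mathcal E(k)\}$ is non-increasing, and for every $k$ with $A_k>0$ (in particular every $k\ge1$) $$f(x_k)-f^*\le\frac{A_0}{A_k}[f(x_0)-f^*]+\frac{\mathrm{dist}_L(x_0,\Omega)^2}{2A_k}.$$ Additionally, with $\tilde\nabla f(x_{k+1}):=\frac{b_k+1}{c_k}L(\tilde x_{k+1}-x_{k+1})$, $$\sum_{k=0}^\infty(a_k+A_k-A_{k+1})\langle\tilde\nabla f(x_{k+1}),x_{k+1}-x^*\rangle\le A_0[f(x_0)-f^*]+\tfrac12\|x_0-x^*\|_L^2\qquad\text{for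 all }x^*\in\Omega,$$ $$\sum_{k=0}^\infty\Big(a_kc_k-\frac{a_k^2}{2}\Big)\|\tilde\nabla f(x_{k+1})\|_{L^{-1}}^2\le A_0[f(x_0)-f^*]+\tfrac12\mathrm{dist}_L(x_0,\Omega)^2 .$$
   Context: $\mathcal H$ is a real Hilbert space with inner product $\langle\cdot,\cdot\rangle$ and norm $\|\cdot\|$. $\Gamma_0(\mathcal H)$ is the set of closed, proper, convex (extended-real-valued) functions on $\mathcal H$; the convention $0\cdot(+\infty)=0$ is used if $f(x_0)=+\infty$. $L:\mathcal H\to\mathcal H$ is a positive definite operator (bounded, linear, self-adjoint, with inverse $L^{-1}$ defined on $\mathcal H$); $\|x\|_L=\sqrt{\langle Lx,x\rangle}$ and $\|x\|_{L^{-1}}=\sqrt{\langle L^{-1}x,x\rangle}$. $\mathrm{dist}_L(x_0,\Omega)=\inf_{x\in\Omega}\|x_0-x\|_L$. The real sequences $\{a_k\},\{b_k\},\{c_k\}$ are positive for $k\ge1$ and non-negative for $k=0$ (with $c_0>0$, since the algorithm divides by $c_k$). *)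

theory Defs
  imports "HOL-Analysis.Analysis"
begin

definition ereal_epigraph :: "('a \<Rightarrow> ereal) \<Rightarrow> ('a \<times> real) set" where
  "ereal_epigraph f = {(x, r). f x \<le> ereal r}"

definition Gamma0 :: "('a::real_inner \<Rightarrow> ereal) set" where
  "Gamma0 = {f. closed (ereal_epigraph f) \<and> convex (ereal_epigraph f)
               \<and> (\<forall>x. f x \<noteq> -\<infinity>) \<and> (\<exists>x. f x \<noteq> \<infinity>)}"

definition minimizers :: "('a \<Rightarrow> ereal) \<Rightarrow> 'a set" where
  "minimizers f = {x. \<forall>y. f x \<le> f y}"

text \<open>Bijectivity makes the inverse \<open>inv L\<close> a genuine two-sided inverse defined on the whole space.\<close>

definition pos_def_operator :: "('a::real_inner \<Rightarrow> 'a) \<Rightarrow> bool" where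
  "pos_def_operator L \<longleftrightarrow>
     bounded_linear L \<and> (\<forall>x y. L x \<bullet> y = x \<bullet> L y) \<and> (\<forall>x. x \<noteq> 0 \<longrightarrow> L x \<bullet> x > 0) \<and> bij L"

definition op_norm :: "('a::real_inner \<Rightarrow> 'a) \<Rightarrow> 'a \<Rightarrow> real" where
  "op_norm L x = sqrt (L x \<bullet> x)"

definition op_dist :: "('a::real_inner \<Rightarrow> 'a) \<Rightarrow> 'a \<Rightarrow> 'a set \<Rightarrow> real" where
  "op_dist L x S = (INF y\<in>S. op_norm L (x - y))"

text \<open>The sequence \<open>xt\<close> is only constrained at positive indices; \<open>xt 0\<close> plays no role.\<close>

definition symplectic_ppa ::
  "('a::real_inner \<Rightarrow> ereal) \<Rightarrow> ('a \<Rightarrow> 'a) \<Rightarrow> (nat \<Rightarrow> real) \<Rightarrow> (nat \<Rightarrow> real) \<Rightarrow> (nat \<Rightarrow> real)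
     \<Rightarrow> (nat \<Rightarrow> 'a) \<Rightarrow> (nat \<Rightarrow> 'a) \<Rightarrow> (nat \<Rightarrow> 'a) \<Rightarrow> bool" where
  "symplectic_ppa f L a b c x xt z \<longleftrightarrow>
     z 0 = x 0 \<and>
     (\<forall>k. xt (Suc k) = (1 / (b k + 1)) *\<^sub>R z k + (b k / (b k + 1)) *\<^sub>R x k \<and>
          is_arg_min (\<lambda>y. f y + ereal ((b k + 1) / (2 * c k) * (op_norm L (y - xt (Suc k)))\<^sup>2))
            (\<lambda>y. True) (x (Suc k)) \<and>
          z (Suc k) = z k + (a k * (b k + 1) / c k) *\<^sub>R (x (Suc k) - xt (Suc k)))"

text \<open>The value at \<open>k\<close> is the subgradient of \<open>f\<close> at \<open>x (Suc k)\<close> produced by the proximal step.\<close>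

definition prox_grad ::
  "('a::real_inner \<Rightarrow> 'a) \<Rightarrow> (nat \<Rightarrow> real) \<Rightarrow> (nat \<Rightarrow> real) \<Rightarrow> (nat \<Rightarrow> 'a) \<Rightarrow> (nat \<Rightarrow> 'a) \<Rightarrow> nat \<Rightarrow> 'a" where
  "prox_grad L b c x xt k = ((b k + 1) / c k) *\<^sub>R L (xt (Suc k) - x (Suc k))"

text \<open>If \<open>A k = 0\<close> and \<open>f (x k) = \<infinity>\<close>, the first summand is \<open>0\<close>, because \<open>0 * \<infinity> = 0\<close>
  in type \<open>ereal\<close>.\<close>

definition energy ::
  "('a::real_inner \<Rightarrow> ereal) \<Rightarrow> ('a \<Rightarrow> 'a) \<Rightarrow> (nat \<Rightarrow> real) \<Rightarrow> (nat \<Rightarrow> 'a) \<Rightarrow> (nat \<Rightarrow> 'a) \<Rightarrow> 'a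
     \<Rightarrow> nat \<Rightarrow> ereal" where
  "energy f L A x z xs k =
     ereal (A k) * (f (x k) - f xs) + ereal (1 / 2 * (op_norm L (z k - xs))\<^sup>2)"

end

theory Submission imports Defs begin

text \<open>The proof is a Lyapunov argument. Write \<open>g\<^sub>k\<close> for \<open>prox_grad L b c x xt k\<close>.
  The optimality condition of the proximal step says that \<open>g\<^sub>k\<close> is a subgradient of \<open>f\<close> at
  \<open>x (Suc k)\<close> (\<open>prox_subgradient\<close>), and the update of \<open>z\<close> reads
  \<open>z (Suc k) = z k - a k *\<^sub>R inv L g\<^sub>k\<close>. Expanding the square \<open>\<parallel>z (Suc k) - xs\<parallel>\<^sub>L\<^sup>2\<close>
  produces the cross term \<open>g\<^sub>k \<bullet> (z k - xs)\<close>; as \<open>xt (Suc k)\<close> is the convex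
  combination of \<open>z k\<close> and \<open>x k\<close> with weights \<open>1 : b k\<close>, this term splits into inner products of
  \<open>g\<^sub>k\<close> with \<open>x (Suc k) - xs\<close> and with \<open>x (Suc k) - x k\<close>, plus a multiple of
  \<open>\<parallel>g\<^sub>k\<parallel>\<^sup>2 = inv L g\<^sub>k \<bullet> g\<^sub>k\<close> (\<open>dual_step_identity\<close>). These two inner products are what the subgradient
  inequalities at \<open>xs\<close> and at \<open>x k\<close> control, and the relation \<open>A k = a k * b k\<close> makes the coefficient
  of the second one cancel. What remains is
  \<open>energy (k+1) + (a\<^sub>k + A\<^sub>k - A\<^sub>k\<^sub>+\<^sub>1) (g\<^sub>k \<bullet> (x\<^sub>k\<^sub>+\<^sub>1 - xs)) + (a\<^sub>k c\<^sub>k - a\<^sub>k\<^sup>2/2) \<parallel>g\<^sub>k\<parallel>\<^sup>2 \<le> energy k\<close>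
  (\<open>energy_step\<close>), where both extra terms are nonnegative by the hypotheses on the parameters and because
  \<open>g\<^sub>k \<bullet> (x\<^sub>k\<^sub>+\<^sub>1 - xs) \<ge> f x\<^sub>k\<^sub>+\<^sub>1 - f xs \<ge> 0\<close>.

  The conclusions on \<open>f\<close> and \<open>g\<^sub>k\<close> follow: monotonicity at once, and the rate and the two series bounds by
  telescoping down to \<open>energy 0\<close> and, where no minimizer is mentioned, passing to the infimum over
  the minimizers (\<open>le_add_half_op_dist\<close>).\<close>

section \<open>The norm of a positive definite operator\<close>

lemma pos_def_operatorD:
  assumes "pos_def_operator L"
  shows "linear L" "L u \<bullet> v = u \<bullet> L v" "L u \<bullet> u \<ge> 0" "inv L (L u) = u"
proof -
  show "linear L"
    using assms unfolding pos_def_operator_def by (blast intro: bounded_linear.linear)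
  show "L u \<bullet> v = u \<bullet> L v"
    using assms unfolding pos_def_operator_def by blast
  show "L u \<bullet> u \<ge> 0"
    using assms unfolding pos_def_operator_def by (cases "u = 0") (auto intro: less_imp_le)
  show "inv L (L u) = u"
    using assms unfolding pos_def_operator_def by (simp add: bij_is_inj)
qed

lemma op_norm_square:
  assumes "pos_def_operator L"
  shows "(op_norm L v)\<^sup>2 = L v \<bullet> v"
  unfolding op_norm_def using pos_def_operatorD(3)[OF assms] by simp

lemma op_norm_square_add:
  assumes "pos_def_operator L"
  shows "(op_norm L (u + t *\<^sub>R v))\<^sup>2 = (op_norm L u)\<^sup>2 + 2 * t * (L u \<bullet> v) + t\<^sup>2 * (op_norm L v)\<^sup>2"
proof -
  have "L v \<bullet> u = L u \<bullet> v"
    using pos_def_operatorD(2)[OF assms, of v u] by (simp add: inner_commute)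
  then show ?thesis
    using pos_def_operatorD(1)[OF assms]
    unfolding op_norm_square[OF assms]
    by (simp add: linear_add linear_scale inner_add_left inner_add_right
        power2_eq_square algebra_simps)
qed

lemma op_norm_inv_square:
  assumes "pos_def_operator L"
  shows "(op_norm (inv L) (L u))\<^sup>2 = L u \<bullet> u"
  unfolding op_norm_def using pos_def_operatorD[OF assms]
  by (metis inner_commute real_sqrt_pow2)

section \<open>Proximal steps and subgradients\<close>

lemma minimizers_eq_INF:
  fixes f :: "'a \<Rightarrow> ereal"
  assumes "xs \<in> minimizers f"
  shows "f xs = (INF y. f y)"
  using assms unfolding minimizers_def by (intro antisym INF_greatest INF_lower) auto

lemma Gamma0_convex:
  assumes "f \<in> Gamma0" "f u = ereal r" "f v = ereal s" "0 \<le> t" "t \<le> 1"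
  shows "f (u + t *\<^sub>R (v - u)) \<le> ereal (r + t * (s - r))"
proof -
  have "convex (ereal_epigraph f)" "(u, r) \<in> ereal_epigraph f" "(v, s) \<in> ereal_epigraph f"
    using assms unfolding Gamma0_def ereal_epigraph_def by auto
  then have "(1 - t) *\<^sub>R (u, r) + t *\<^sub>R (v, s) \<in> ereal_epigraph f"
    using assms(4,5) by (intro convexD) auto
  then show ?thesis
    by (simp add: ereal_epigraph_def algebra_simps)
qed

text \<open>Since \<open>f\<close> is finite somewhere, the minimal value of the penalized function is finite.\<close>

lemma prox_point_finite:
  fixes f :: "'a::real_inner \<Rightarrow> ereal"
  assumes "f \<in> Gamma0" "is_arg_min (\<lambda>y. f y + ereal (q y)) (\<lambda>_. True) p"
  obtains F where "f p = ereal F"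
proof -
  obtain y where "f y \<noteq> \<infinity>" using assms(1) unfolding Gamma0_def by auto
  moreover have "f p + ereal (q p) \<le> f y + ereal (q y)"
    using assms(2) unfolding is_arg_min_def by (meson not_less)
  moreover have "f p \<noteq> -\<infinity>" using assms(1) unfolding Gamma0_def by auto
  ultimately show thesis by (cases "f p"; cases "f y") (auto intro: that)
qed

text \<open>Optimality condition of the proximal step. Moving from the minimizer \<open>p\<close> towards \<open>y\<close> by
  a fraction \<open>t\<close> changes \<open>f\<close> by at most \<open>t * (f y - f p)\<close> and the penalty by a linear term in
  \<open>t\<close> plus \<open>O(t\<^sup>2)\<close>; dividing by \<open>t\<close> and letting \<open>t\<close> tend to \<open>0\<close> leaves the subgradient
  inequality.\<close>

lemma prox_subgradient:
  fixes f :: "'a::real_inner \<Rightarrow> ereal"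
  assumes f: "f \<in> Gamma0" and L: "pos_def_operator L"
    and min: "is_arg_min (\<lambda>y. f y + ereal (\<mu> * (op_norm L (y - w))\<^sup>2)) (\<lambda>_. True) p"
  shows "f p + ereal (((2 * \<mu>) *\<^sub>R L (w - p)) \<bullet> (y - p)) \<le> f y"
proof (cases "f y")
  case (real Y)
  obtain F where F: "f p = ereal F" using prox_point_finite[OF f min] .
  let ?G = "L (p - w) \<bullet> (y - p)"
  let ?K = "\<mu> * (op_norm L (y - p))\<^sup>2"
  have bound: "F - Y - 2 * \<mu> * ?G \<le> t * ?K" if "0 < t" "t < 1" for t :: real
  proof -
    let ?v = "p + t *\<^sub>R (y - p)"
    have "f p + ereal (\<mu> * (op_norm L (p - w))\<^sup>2) \<le> f ?v + ereal (\<mu> * (op_norm L (?v - w))\<^sup>2)"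
      using min unfolding is_arg_min_def by (meson not_less)
    also have "\<dots> \<le> ereal (F + t * (Y - F)) + ereal (\<mu> * (op_norm L (?v - w))\<^sup>2)"
      using Gamma0_convex[OF f F real, of t] that by (intro add_right_mono) auto
    finally have "F + \<mu> * (op_norm L (p - w))\<^sup>2
        \<le> F + t * (Y - F) + \<mu> * (op_norm L (?v - w))\<^sup>2"
      by (simp add: F)
    moreover have "?v - w = (p - w) + t *\<^sub>R (y - p)" by simp
    ultimately have "t * (F - Y - 2 * \<mu> * ?G) \<le> t * (t * ?K)"
      by (simp only: op_norm_square_add[OF L]) (simp add: algebra_simps power2_eq_square)
    then show ?thesis using that by simp
  qed
  have "((\<lambda>t. t * ?K) \<longlongrightarrow> 0 * ?K) (at_right (0::real))"
    by (intro tendsto_intros)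
  moreover have "\<forall>\<^sub>F t in at_right (0::real). F - Y - 2 * \<mu> * ?G \<le> t * ?K"
    using eventually_at_right_real[OF zero_less_one] by (rule eventually_mono) (auto intro: bound)
  ultimately have "F - Y - 2 * \<mu> * ?G \<le> 0 * ?K"
    by (intro tendsto_lowerbound) auto
  moreover have "L (w - p) = - L (p - w)"
    using linear_diff[OF pos_def_operatorD(1)[OF L]] by simp
  ultimately show ?thesis by (simp add: F real)
next
  case MInf
  then show ?thesis using f unfolding Gamma0_def by auto
qed simp

section \<open>Dissipation of energy\<close>

text \<open>The expansion of the new squared distance. The vector \<open>(b + 1) / c *\<^sub>R (w - p)\<close> is
  \<open>inv L g\<close>, so the update is \<open>z' = z - a *\<^sub>R inv L g\<close>, and solving the definition of \<open>w\<close> for \<open>z\<close>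
  gives \<open>z - v = c *\<^sub>R inv L g + (p - v) + b *\<^sub>R (p - y)\<close>.\<close>

lemma dual_step_identity:
  fixes z y w p :: "'a::real_inner"
  assumes L: "pos_def_operator L" and "b \<ge> 0" "c > 0"
    and w: "w = (1 / (b + 1)) *\<^sub>R z + (b / (b + 1)) *\<^sub>R y"
    and g: "g = ((b + 1) / c) *\<^sub>R L (w - p)"
    and z': "z' = z + (a * (b + 1) / c) *\<^sub>R (p - w)"
  shows "1 / 2 * (op_norm L (z' - v))\<^sup>2 = 1 / 2 * (op_norm L (z - v))\<^sup>2
      - a * (g \<bullet> (p - v)) - a * b * (g \<bullet> (p - y))
      - (a * c - a\<^sup>2 / 2) * (op_norm (inv L) g)\<^sup>2"
proof -
  define h where "h = ((b + 1) / c) *\<^sub>R (w - p)"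
  have g_h: "g = L h"
    unfolding g h_def using linear_scale[OF pos_def_operatorD(1)[OF L]] by simp
  have "(b + 1) *\<^sub>R w = z + b *\<^sub>R y"
    using \<open>b \<ge> 0\<close> by (simp add: w scaleR_add_right)
  moreover have "c *\<^sub>R h = (b + 1) *\<^sub>R w - (b + 1) *\<^sub>R p"
    using \<open>c > 0\<close> by (simp add: h_def scaleR_diff_right)
  ultimately have z: "z - v = c *\<^sub>R h + (p - v) + b *\<^sub>R (p - y)"
    by (simp add: algebra_simps)
  have cross: "L (z - v) \<bullet> h = c * (g \<bullet> h) + g \<bullet> (p - v) + b * (g \<bullet> (p - y))"
  proof -
    have "L (z - v) \<bullet> h = g \<bullet> (z - v)"
      using pos_def_operatorD(2)[OF L, of "z - v" h] by (simp add: g_h inner_commute)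
    then show ?thesis by (simp add: z inner_add_right)
  qed
  have "z' - v = (z - v) + (- a) *\<^sub>R h"
    by (simp add: z' h_def scaleR_diff_right)
  then have "(op_norm L (z' - v))\<^sup>2
      = (op_norm L (z - v))\<^sup>2 + 2 * (- a) * (L (z - v) \<bullet> h) + (- a)\<^sup>2 * (op_norm L h)\<^sup>2"
    by (simp only: op_norm_square_add[OF L])
  also have "(op_norm L h)\<^sup>2 = g \<bullet> h" by (simp add: op_norm_square[OF L] g_h)
  finally show ?thesis
    unfolding cross g_h op_norm_inv_square[OF L] by (simp add: algebra_simps power2_eq_square)
qed

text \<open>One step of the method dissipates energy. The two subgradient inequalities used are those
  at \<open>xs\<close>, with weight \<open>A (Suc k) - A k\<close>, and at \<open>x k\<close>, with weight \<open>A k\<close>. The latter is kept as a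
  lower bound of \<open>ereal (A k) * (f (x k) - f xs)\<close>, which remains valid if \<open>f (x k) = \<infinity>\<close>.\<close>

lemma energy_step:
  fixes f :: "'a::real_inner \<Rightarrow> ereal"
  assumes f: "f \<in> Gamma0" and L: "pos_def_operator L" and xs: "xs \<in> minimizers f"
    and ppa: "symplectic_ppa f L a b c x xt z"
    and bc: "b k \<ge> 0" "c k > 0" and A: "A k = a k * b k" "A k \<ge> 0" "A k \<le> A (Suc k)"
  defines "g \<equiv> prox_grad L b c x xt"
  shows "energy f L A x z xs (Suc k)
        + ereal ((a k + A k - A (Suc k)) * (g k \<bullet> (x (Suc k) - xs))
            + (a k * c k - (a k)\<^sup>2 / 2) * (op_norm (inv L) (g k))\<^sup>2)
      \<le> energy f L A x z xs k"
    and "g k \<bullet> (x (Suc k) - xs) \<ge> 0"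
proof -
  let ?\<mu> = "(b k + 1) / (2 * c k)"
  have w: "xt (Suc k) = (1 / (b k + 1)) *\<^sub>R z k + (b k / (b k + 1)) *\<^sub>R x k"
    and min: "is_arg_min (\<lambda>y. f y + ereal (?\<mu> * (op_norm L (y - xt (Suc k)))\<^sup>2))
        (\<lambda>_. True) (x (Suc k))"
    and z': "z (Suc k) = z k + (a k * (b k + 1) / c k) *\<^sub>R (x (Suc k) - xt (Suc k))"
    using ppa unfolding symplectic_ppa_def by blast+
  have g: "g k = ((b k + 1) / c k) *\<^sub>R L (xt (Suc k) - x (Suc k))"
    by (simp add: g_def prox_grad_def)
  obtain F where F: "f (x (Suc k)) = ereal F" using prox_point_finite[OF f min] .
  have sub: "ereal (F - g k \<bullet> (x (Suc k) - y)) \<le> f y" for y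
  proof -
    have "2 * ?\<mu> = (b k + 1) / c k" using bc by (simp add: field_simps)
    then have "g k = (2 * ?\<mu>) *\<^sub>R L (xt (Suc k) - x (Suc k))" by (simp only: g)
    then have "f (x (Suc k)) + ereal (g k \<bullet> (y - x (Suc k))) \<le> f y"
      using prox_subgradient[OF f L min, of y] by simp
    then show ?thesis by (simp add: F inner_diff_right algebra_simps)
  qed
  have le: "f xs \<le> f y" for y using xs unfolding minimizers_def by auto
  obtain m where m: "f xs = ereal m"
  proof (cases "f xs")
    case PInf
    then show thesis using le[of "x (Suc k)"] F by simp
  next
    case MInf
    then show thesis using f unfolding Gamma0_def by auto
  qed (use that in auto)
  have opt: "F - m \<le> g k \<bullet> (x (Suc k) - xs)" using sub[of xs] by (simp add: m)
  have "m \<le> F" using le[of "x (Suc k)"] by (simp add: m F)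
  with opt show "g k \<bullet> (x (Suc k) - xs) \<ge> 0" by linarith
  have "ereal (F - g k \<bullet> (x (Suc k) - x k) - m) \<le> f (x k) - f xs"
    using sub[of "x k"] by (cases "f (x k)") (auto simp: m)
  then have "ereal (A k) * ereal (F - g k \<bullet> (x (Suc k) - x k) - m)
      \<le> ereal (A k) * (f (x k) - f xs)"
    using A by (intro ereal_mult_left_mono) auto
  then have old: "ereal (A k * (F - g k \<bullet> (x (Suc k) - x k) - m)
        + 1 / 2 * (op_norm L (z k - xs))\<^sup>2) \<le> energy f L A x z xs k"
    unfolding energy_def plus_ereal.simps(1)[symmetric] by (intro add_right_mono) simp
  have "(A (Suc k) - A k) * (F - m) \<le> (A (Suc k) - A k) * (g k \<bullet> (x (Suc k) - xs))"
    using opt A by (intro mult_left_mono) auto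
  then have "A (Suc k) * (F - m) + 1 / 2 * (op_norm L (z (Suc k) - xs))\<^sup>2
        + ((a k + A k - A (Suc k)) * (g k \<bullet> (x (Suc k) - xs))
            + (a k * c k - (a k)\<^sup>2 / 2) * (op_norm (inv L) (g k))\<^sup>2)
      \<le> A k * (F - g k \<bullet> (x (Suc k) - x k) - m) + 1 / 2 * (op_norm L (z k - xs))\<^sup>2"
    unfolding dual_step_identity[OF L bc w g z', of xs] A(1) by (simp add: algebra_simps)
  then have "ereal (A (Suc k) * (F - m) + 1 / 2 * (op_norm L (z (Suc k) - xs))\<^sup>2
        + ((a k + A k - A (Suc k)) * (g k \<bullet> (x (Suc k) - xs))
            + (a k * c k - (a k)\<^sup>2 / 2) * (op_norm (inv L) (g k))\<^sup>2))
      \<le> energy f L A x z xs k"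
    using old by (meson ereal_less_eq(3) order_trans)
  then show "energy f L A x z xs (Suc k)
        + ereal ((a k + A k - A (Suc k)) * (g k \<bullet> (x (Suc k) - xs))
            + (a k * c k - (a k)\<^sup>2 / 2) * (op_norm (inv L) (g k))\<^sup>2)
      \<le> energy f L A x z xs k"
    by (simp add: energy_def F m)
qed

section \<open>Summation and passage to the distance\<close>

lemma ereal_telescope:
  fixes e :: "nat \<Rightarrow> ereal" and d :: "nat \<Rightarrow> real"
  assumes "\<And>k. e (Suc k) + ereal (d k) \<le> e k"
  shows "e n + ereal (\<Sum>k<n. d k) \<le> e 0"
proof (induction n)
  case (Suc n)
  have "e (Suc n) + ereal (\<Sum>k<Suc n. d k) = (e (Suc n) + ereal (d n)) + ereal (\<Sum>k<n. d k)"
    by (cases "e (Suc n)") simp_all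
  also have "\<dots> \<le> e n + ereal (\<Sum>k<n. d k)" by (intro add_right_mono assms)
  finally show ?case using Suc.IH by (rule order_trans)
qed simp

text \<open>The distance is an infimum of norms, while the energy contains squared norms. Squaring is
  monotone on the nonnegative reals, so the infimum may be taken after extracting a square root.\<close>

lemma le_add_half_op_dist:
  fixes C s :: ereal
  assumes L: "pos_def_operator L" and "S \<noteq> {}" and "C \<noteq> -\<infinity>"
    and bound: "\<And>y. y \<in> S \<Longrightarrow> s \<le> C + ereal (1 / 2 * (op_norm L (u - y))\<^sup>2)"
  shows "s \<le> C + ereal (1 / 2 * (op_dist L u S)\<^sup>2)"
proof (cases C)
  case (real r)
  show ?thesis
  proof (cases s)
    case (real s')
    have n0: "0 \<le> op_norm L y" for y
      unfolding op_norm_def using pos_def_operatorD(3)[OF L] by simp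
    have sq: "2 * (s' - r) \<le> (op_norm L (u - y))\<^sup>2" if "y \<in> S" for y
      using bound[OF that] \<open>C = ereal r\<close> real by simp
    have "2 * (s' - r) \<le> (op_dist L u S)\<^sup>2"
    proof (cases "s' \<le> r")
      case True
      then show ?thesis by (intro order_trans[OF _ zero_le_power2]) simp
    next
      case False
      have "sqrt (2 * (s' - r)) \<le> op_dist L u S"
        unfolding op_dist_def using \<open>S \<noteq> {}\<close> sq n0
        by (intro cINF_greatest) (auto intro: real_le_lsqrt)
      then have "(sqrt (2 * (s' - r)))\<^sup>2 \<le> (op_dist L u S)\<^sup>2"
        using False by (intro power_mono) auto
      then show ?thesis using False by simp
    qed
    then show ?thesis using \<open>C = ereal r\<close> real by simp
  next
    case PInf
    then show ?thesis using bound \<open>S \<noteq> {}\<close> \<open>C = ereal r\<close> by auto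
  qed simp
qed (use \<open>C \<noteq> -\<infinity>\<close> in auto)

lemma ereal_divide_bound:
  fixes u v :: ereal
  assumes "\<alpha> > 0" "\<beta> \<ge> 0" "v \<ge> 0" and le: "ereal \<alpha> * u \<le> ereal \<beta> * v + ereal (1 / 2 * d)"
  shows "u \<le> ereal (\<beta> / \<alpha>) * v + ereal (d / (2 * \<alpha>))"
proof -
  have "ereal (1 / \<alpha>) * (ereal \<alpha> * u) \<le> ereal (1 / \<alpha>) * (ereal \<beta> * v + ereal (1 / 2 * d))"
    using le \<open>\<alpha> > 0\<close> by (intro ereal_mult_left_mono) auto
  also have "\<dots> = ereal (1 / \<alpha>) * (ereal \<beta> * v) + ereal (1 / \<alpha>) * ereal (1 / 2 * d)"
    by (rule ereal_pos_distrib) (use \<open>\<alpha> > 0\<close> in auto)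
  finally show ?thesis
    using assms(1-3) by (cases u; cases v) (auto simp: field_simps split: if_splits)
qed

theorem theorem4:
  fixes f :: "'a::{real_inner, complete_space} \<Rightarrow> ereal"
    and L :: "'a \<Rightarrow> 'a"
    and a b c A :: "nat \<Rightarrow> real"
    and x xt z :: "nat \<Rightarrow> 'a"
    and \<Omega> :: "'a set"
    and fstar :: ereal
  assumes "f \<in> Gamma0"
    and "pos_def_operator L"
    and "\<Omega> = minimizers f" and "\<Omega> \<noteq> {}"
    and "fstar = (INF y. f y)"
    and "a 0 \<ge> 0" and "b 0 \<ge> 0" and "c 0 > 0"
    and "\<And>k. k \<ge> 1 \<Longrightarrow> a k > 0 \<and> b k > 0 \<and> c k > 0"
    and "symplectic_ppa f L a b c x xt z"
    and "\<And>k. A k = a k * b k"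
    and "\<And>k. 0 \<le> A (Suc k) - A k \<and> A (Suc k) - A k \<le> a k"
    and "\<And>k. c k \<ge> a k / 2"
  shows "(\<forall>xs\<in>\<Omega>. decseq (energy f L A x z xs))
    \<and> (\<forall>k\<ge>1. A k > 0)
    \<and> (\<forall>k. A k > 0 \<longrightarrow>
          f (x k) - fstar \<le> ereal (A 0 / A k) * (f (x 0) - fstar)
                            + ereal ((op_dist L (x 0) \<Omega>)\<^sup>2 / (2 * A k)))
    \<and> (\<forall>xs\<in>\<Omega>.
          (\<Sum>k. ereal ((a k + A k - A (Suc k)) * (prox_grad L b c x xt k \<bullet> (x (Suc k) - xs))))
          \<le> ereal (A 0) * (f (x 0) - fstar) + ereal (1 / 2 * (op_norm L (x 0 - xs))\<^sup>2))
    \<and> (\<Sum>k. ereal ((a k * c k - (a k)\<^sup>2 / 2) * (op_norm (inv L) (prox_grad L b c x xt k))\<^sup>2))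
          \<le> ereal (A 0) * (f (x 0) - fstar) + ereal (1 / 2 * (op_dist L (x 0) \<Omega>)\<^sup>2)"
proof -
  note f = assms(1) and L = assms(2) and ppa = assms(10) and A_eq = assms(11)
  have a: "a k \<ge> 0" and b: "b k \<ge> 0" and c: "c k > 0" for k
    using assms(6,7,8) assms(9)[of k] by (cases k; simp)+
  have A0: "A k \<ge> 0" for k using A_eq a b by simp
  have A_mono: "A k \<le> A (Suc k)" for k using assms(12)[of k] by simp
  define g where "g = prox_grad L b c x xt"
  define d1 where "d1 xs k = (a k + A k - A (Suc k)) * (g k \<bullet> (x (Suc k) - xs))" for xs k
  define d2 where "d2 k = (a k * c k - (a k)\<^sup>2 / 2) * (op_norm (inv L) (g k))\<^sup>2" for k
  have d1: "d1 xs k \<ge> 0" if "xs \<in> \<Omega>" for xs k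
    using energy_step(2)[OF f L _ ppa b c A_eq A0 A_mono] that assms(3) assms(12)[of k]
    unfolding d1_def g_def by (intro mult_nonneg_nonneg) auto
  have d2: "d2 k \<ge> 0" for k
  proof -
    have "a k * c k - (a k)\<^sup>2 / 2 = a k * (c k - a k / 2)"
      by (simp add: algebra_simps power2_eq_square)
    then show ?thesis using a[of k] assms(13)[of k] unfolding d2_def by simp
  qed
  have step: "energy f L A x z xs (Suc k) + ereal (d1 xs k + d2 k) \<le> energy f L A x z xs k"
    if "xs \<in> \<Omega>" for xs k
    using energy_step(1)[OF f L _ ppa b c A_eq A0 A_mono] that assms(3)
    unfolding d1_def d2_def g_def by blast
  have fs: "f xs = fstar" if "xs \<in> \<Omega>" for xs
    using minimizers_eq_INF[of xs f] that assms(3,5) by simp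
  define C where "C = ereal (A 0) * (f (x 0) - fstar)"
  have gap: "f y - fstar \<ge> 0" for y
  proof -
    have "fstar \<le> f y" unfolding assms(5) by (rule INF_lower) simp
    moreover obtain y' where "f y' \<noteq> \<infinity>" using f unfolding Gamma0_def by auto
    moreover have "fstar \<le> f y'" unfolding assms(5) by (rule INF_lower) simp
    moreover have "fstar \<noteq> -\<infinity>"
      using fs f assms(4) unfolding Gamma0_def by force
    ultimately show ?thesis by (cases fstar; cases "f y"; auto)
  qed
  have C0: "C \<ge> 0" unfolding C_def using gap A0 by simp
  have z0: "z 0 = x 0" using ppa unfolding symplectic_ppa_def by simp
  have E0: "energy f L A x z xs 0 = C + ereal (1 / 2 * (op_norm L (x 0 - xs))\<^sup>2)"
    if "xs \<in> \<Omega>" for xs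
    unfolding energy_def C_def using fs[OF that] z0 by simp
  have tele: "energy f L A x z xs n + ereal (\<Sum>k<n. d1 xs k + d2 k)
      \<le> C + ereal (1 / 2 * (op_norm L (x 0 - xs))\<^sup>2)" if "xs \<in> \<Omega>" for xs n
    unfolding E0[OF that, symmetric] by (rule ereal_telescope) (rule step[OF that])
  have E_lower: "ereal (A n) * (f (x n) - fstar) \<le> energy f L A x z xs n" if "xs \<in> \<Omega>" for xs n
    unfolding energy_def fs[OF that] by (rule add_increasing2) auto
  have E_nonneg: "energy f L A x z xs n \<ge> 0" if "xs \<in> \<Omega>" for xs n
    by (rule order_trans[OF _ E_lower[OF that]]) (simp add: gap A0)
  have partial_sum: "ereal (\<Sum>k<n. d1 xs k + d2 k)
      \<le> C + ereal (1 / 2 * (op_norm L (x 0 - xs))\<^sup>2)" if "xs \<in> \<Omega>" for xs n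
    by (rule order_trans[OF _ tele[OF that]]) (rule add_increasing[OF E_nonneg[OF that] order_refl])

  have monotone: "decseq (energy f L A x z xs)" if "xs \<in> \<Omega>" for xs
  proof (rule decseq_SucI)
    fix k
    have "energy f L A x z xs (Suc k) + 0 \<le> energy f L A x z xs (Suc k) + ereal (d1 xs k + d2 k)"
      using d1[OF that, of k] d2[of k] by (intro add_left_mono) simp
    then show "energy f L A x z xs (Suc k) \<le> energy f L A x z xs k"
      using step[OF that, of k] by simp
  qed
  have A_pos: "A k > 0" if "k \<ge> 1" for k
    using A_eq assms(9)[OF that] by simp
  have rate: "f (x k) - fstar \<le> ereal (A 0 / A k) * (f (x 0) - fstar)
      + ereal ((op_dist L (x 0) \<Omega>)\<^sup>2 / (2 * A k))" if "A k > 0" for k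
  proof (rule ereal_divide_bound[OF that A0 gap])
    have "ereal (A k) * (f (x k) - fstar) \<le> C + ereal (1 / 2 * (op_norm L (x 0 - xs))\<^sup>2)"
      if xs: "xs \<in> \<Omega>" for xs
    proof -
      have "energy f L A x z xs k + 0 \<le> energy f L A x z xs k + ereal (\<Sum>j<k. d1 xs j + d2 j)"
        using d1[OF xs] d2 by (intro add_left_mono) (simp add: sum_nonneg)
      then show ?thesis using E_lower[OF xs, of k] tele[OF xs, of k] by simp
    qed
    then show "ereal (A k) * (f (x k) - fstar) \<le> ereal (A 0) * (f (x 0) - fstar)
        + ereal (1 / 2 * (op_dist L (x 0) \<Omega>)\<^sup>2)"
      unfolding C_def[symmetric] using C0 assms(4) by (intro le_add_half_op_dist[OF L]) auto
  qed
  have first_series: "(\<Sum>k. ereal (d1 xs k)) \<le> C + ereal (1 / 2 * (op_norm L (x 0 - xs))\<^sup>2)"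
    if "xs \<in> \<Omega>" for xs
  proof (rule suminf_bound, rule allI)
    fix n
    show "(\<Sum>k<n. ereal (d1 xs k)) \<le> C + ereal (1 / 2 * (op_norm L (x 0 - xs))\<^sup>2)"
    proof (rule order_trans[OF _ partial_sum[OF that, of n]])
      show "(\<Sum>k<n. ereal (d1 xs k)) \<le> ereal (\<Sum>k<n. d1 xs k + d2 k)"
        using d2 by (simp add: sum_mono)
    qed
  qed (use d1[OF that] in simp)
  have second_series: "(\<Sum>k. ereal (d2 k)) \<le> C + ereal (1 / 2 * (op_dist L (x 0) \<Omega>)\<^sup>2)"
  proof (rule le_add_half_op_dist[OF L])
    fix xs assume xs: "xs \<in> \<Omega>"
    show "(\<Sum>k. ereal (d2 k)) \<le> C + ereal (1 / 2 * (op_norm L (x 0 - xs))\<^sup>2)"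
    proof (rule suminf_bound, rule allI)
      fix n
      show "(\<Sum>k<n. ereal (d2 k)) \<le> C + ereal (1 / 2 * (op_norm L (x 0 - xs))\<^sup>2)"
      proof (rule order_trans[OF _ partial_sum[OF xs, of n]])
        show "(\<Sum>k<n. ereal (d2 k)) \<le> ereal (\<Sum>k<n. d1 xs k + d2 k)"
          using d1[OF xs] by (simp add: sum_mono)
      qed
    qed (use d2 in simp)
  qed (use C0 assms(4) in auto)
  show ?thesis
    by (intro conjI ballI allI impI)
      ((rule monotone A_pos rate first_series[unfolded C_def d1_def g_def], assumption)
        | rule second_series[unfolded C_def d2_def g_def])+
qed

end
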